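(* Let $N\geq 2$ and let $$I_{(N)} = \sum_{i\neq j} \Big( \operatorname{sgn}(x_{ij})\, (-1)^{s_j + s_i}\, a_j^2\, x_i + \tfrac{3}{2}\, a_i a_j e^{-|x_{ij}|} \Big),$$ which is a permutation-invariant local constant of motion of the mCH $N$-peakon dynamical system $$\dot a_i = 0,\qquad \dot x_i = \tfrac{2}{3} a_i^2 + 2 a_i \sum_{j \neq i} a_j e^{-|x_{ij}|} + 2\sum_{\substack{j <k\\ j,k \neq i}} a_j a_k \big(1-\operatorname{sgn}(x_{ij}) \operatorname{sgn}(x_{ik})\big)e^{-|x_{ij}|-|x_{ik}|},\qquad i=1,\ldots,N.$$ Then $$H(a_i,x_i)= \tfrac{4}{3} I_{(N)}$$ is a Hamiltonian for this dynamical system using the Poisson bracket $$\{ a_i, a_j \} =0,\qquad \{ a_i, x_j \} = - \{ x_j, a_i \} =0,\qquad \{ x_i, x_j \}= \tfrac{1}{2}\operatorname{sgn}(x_i-x_j)$$ (that is, the Hamiltonian equations of motion $\dot a_i=\{a_i,H\}$, $\dot x_i=\{x_i,H\}$, $i=1,\ldots,N$, coincide with the dynamical system) if and only if $N$ is even.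
   Context: The dynamical variables are real amplitudes $a_i(t)$ and positions $x_i(t)$, $i=1,\ldots,N$, and $x_{ij}=x_i-x_j$. All summation indices run from $1$ to $N$. Here $\operatorname{sgn}(x)=\pm1$ for $\pm x>0$ and $\operatorname{sgn}(0)=0$. The integer $s_k$ denotes the number of signs that are equal to $+1$ in the list $(\operatorname{sgn}(x_{1k}),\ldots,\operatorname{sgn}(x_{Nk}))$; thus $s_k$ is the number of indices $j$ with $x_j>x_k$. A local constant of motion is a function of the $a_i,x_i$ (no explicit dependence on $t$) whose time derivative along solutions vanishes at all times at which the positions are distinct; permutation-invariant means invariant under all permutations of the pairs $(a_i,x_i)$. The Poisson bracket is extended from the structure functions to functions of the dynamical variables by $$\{f,g\}=\sum_{i,j}\Big(\{a_i,a_j\}\tfrac{\partial f}{\partial a_i}\tfrac{\partial g}{\partial a_j}+\{a_i,x_j\}\tfrac{\partial f}{\partial a_i}\tfrac{\partial g}{\partial x_j}+\{x_i,a_j\}\tfrac{\partial f}{\partial x_i}\tfrac{\partial g}{\partial a_j}+\{x_i,x_j\}\tfrac{\partial f}{\partial x_i}\tfrac{\partial g}{\partial x_j}\Big).$$ All statements are understood where the positions are distinct ($x_{ij}\neq0$ for $i\neq j$), so that the sign functions and the integers $s_k$ are locally constant when differentiating. *)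

theory Defs
  imports "HOL-Analysis.Analysis"
begin

text \<open>
  The dynamical variables are families \<open>a, x :: nat \<Rightarrow> real\<close>, of which only the entries with
  index in \<open>{1..N}\<close> are relevant. A function of the dynamical variables takes the amplitudes
  first and the positions second.
\<close>

type_synonym phase_fun = "(nat \<Rightarrow> real) \<Rightarrow> (nat \<Rightarrow> real) \<Rightarrow> real"

definition distinct_positions :: "nat \<Rightarrow> (nat \<Rightarrow> real) \<Rightarrow> bool" where
  "distinct_positions N x \<longleftrightarrow> inj_on x {1..N}"

definition coord_a :: "nat \<Rightarrow> phase_fun" where
  "coord_a i = (\<lambda>a x. a i)"

definition coord_x :: "nat \<Rightarrow> phase_fun" where
  "coord_x i = (\<lambda>a x. x i)"

definition partial_a :: "nat \<Rightarrow> phase_fun \<Rightarrow> phase_fun" where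
  "partial_a i F = (\<lambda>a x. deriv (\<lambda>u. F (a(i := u)) x) (a i))"

definition partial_x :: "nat \<Rightarrow> phase_fun \<Rightarrow> phase_fun" where
  "partial_x i F = (\<lambda>a x. deriv (\<lambda>u. F a (x(i := u))) (x i))"

text \<open>
  The bracket determined by structure functions \<open>aa i j\<close>, \<open>ax i j\<close>, \<open>xa i j\<close>, \<open>xx i j\<close>, standing
  for the brackets of \<open>a\<^sub>i, a\<^sub>j\<close>, of \<open>a\<^sub>i, x\<^sub>j\<close>, of \<open>x\<^sub>i, a\<^sub>j\<close> and of \<open>x\<^sub>i, x\<^sub>j\<close>.
\<close>

definition bracket ::
  "nat \<Rightarrow> (nat \<Rightarrow> nat \<Rightarrow> phase_fun) \<Rightarrow> (nat \<Rightarrow> nat \<Rightarrow> phase_fun) \<Rightarrow> (nat \<Rightarrow> nat \<Rightarrow> phase_fun)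
    \<Rightarrow> (nat \<Rightarrow> nat \<Rightarrow> phase_fun) \<Rightarrow> phase_fun \<Rightarrow> phase_fun \<Rightarrow> phase_fun" where
  "bracket N aa ax xa xx F G = (\<lambda>a x. \<Sum>i\<in>{1..N}. \<Sum>j\<in>{1..N}.
      aa i j a x * partial_a i F a x * partial_a j G a x
    + ax i j a x * partial_a i F a x * partial_x j G a x
    + xa i j a x * partial_x i F a x * partial_a j G a x
    + xx i j a x * partial_x i F a x * partial_x j G a x)"

definition peakon_bracket :: "nat \<Rightarrow> phase_fun \<Rightarrow> phase_fun \<Rightarrow> phase_fun" where
  "peakon_bracket N = bracket N (\<lambda>i j a x. 0) (\<lambda>i j a x. 0) (\<lambda>i j a x. 0)
     (\<lambda>i j a x. 1/2 * sgn (x i - x j))"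

definition mch_a_dot :: "nat \<Rightarrow> nat \<Rightarrow> phase_fun" where
  "mch_a_dot N i = (\<lambda>a x. 0)"

definition mch_x_dot :: "nat \<Rightarrow> nat \<Rightarrow> phase_fun" where
  "mch_x_dot N i = (\<lambda>a x. 2/3 * (a i)\<^sup>2
     + 2 * a i * (\<Sum>j\<in>{1..N} - {i}. a j * exp (- \<bar>x i - x j\<bar>))
     + 2 * (\<Sum>(j, k)\<in>{(j, k). j \<in> {1..N} - {i} \<and> k \<in> {1..N} - {i} \<and> j < k}.
          a j * a k * (1 - sgn (x i - x j) * sgn (x i - x k))
            * exp (- \<bar>x i - x j\<bar> - \<bar>x i - x k\<bar>)))"

definition solution_on ::
  "nat \<Rightarrow> (nat \<Rightarrow> phase_fun) \<Rightarrow> (nat \<Rightarrow> phase_fun) \<Rightarrow> real set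
    \<Rightarrow> (real \<Rightarrow> nat \<Rightarrow> real) \<Rightarrow> (real \<Rightarrow> nat \<Rightarrow> real) \<Rightarrow> bool" where
  "solution_on N A X T a x \<longleftrightarrow> (\<forall>t\<in>T. \<forall>i\<in>{1..N}.
      ((\<lambda>\<tau>. a \<tau> i) has_real_derivative A i (a t) (x t)) (at t)
    \<and> ((\<lambda>\<tau>. x \<tau> i) has_real_derivative X i (a t) (x t)) (at t))"

definition local_constant_of_motion ::
  "nat \<Rightarrow> (nat \<Rightarrow> phase_fun) \<Rightarrow> (nat \<Rightarrow> phase_fun) \<Rightarrow> phase_fun \<Rightarrow> bool" where
  "local_constant_of_motion N A X F \<longleftrightarrow>
     (\<forall>T a x. open T \<and> is_interval T \<and> solution_on N A X T a x \<longrightarrow>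
       (\<forall>t\<in>T. distinct_positions N (x t) \<longrightarrow>
         ((\<lambda>\<tau>. F (a \<tau>) (x \<tau>)) has_real_derivative 0) (at t)))"

definition permutation_invariant :: "nat \<Rightarrow> phase_fun \<Rightarrow> bool" where
  "permutation_invariant N F \<longleftrightarrow>
     (\<forall>\<pi> a x. \<pi> permutes {1..N} \<longrightarrow> F (a \<circ> \<pi>) (x \<circ> \<pi>) = F a x)"

definition is_hamiltonian_for ::
  "nat \<Rightarrow> (phase_fun \<Rightarrow> phase_fun \<Rightarrow> phase_fun) \<Rightarrow> (nat \<Rightarrow> phase_fun) \<Rightarrow> (nat \<Rightarrow> phase_fun)
    \<Rightarrow> phase_fun \<Rightarrow> bool" where
  "is_hamiltonian_for N B A X H \<longleftrightarrow>
     (\<forall>a x. distinct_positions N x \<longrightarrow> (\<forall>i\<in>{1..N}.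
        A i a x = B (coord_a i) H a x \<and> X i a x = B (coord_x i) H a x))"

definition sgn_count :: "nat \<Rightarrow> (nat \<Rightarrow> real) \<Rightarrow> nat \<Rightarrow> nat" where
  "sgn_count N x k = card {j \<in> {1..N}. sgn (x j - x k) = 1}"

definition peakon_I :: "nat \<Rightarrow> phase_fun" where
  "peakon_I N = (\<lambda>a x. \<Sum>(i, j)\<in>{(i, j). i \<in> {1..N} \<and> j \<in> {1..N} \<and> i \<noteq> j}.
      sgn (x i - x j) * (-1) ^ (sgn_count N x j + sgn_count N x i) * (a j)\<^sup>2 * x i
    + 3/2 * a i * a j * exp (- \<bar>x i - x j\<bar>))"

end

theory Submission
  imports Defs
begin

text \<open>
  Let \<open>v\<^sub>k\<close> be the derivative of \<open>I\<close> with respect to \<open>x\<^sub>k\<close>. The exponential terms of the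
  Hamiltonian vector field \<open>2/3 \<Sum>\<^sub>k sgn(x\<^sub>i - x\<^sub>k) v\<^sub>k\<close> reproduce those of the peakon system.
  For the quadratic terms, \<open>s\<close> ranks the positions in decreasing order, so that the coefficient of
  \<open>a\<^sub>j\<^sup>2\<close> is an alternating sum over \<open>{..<N}\<close>; it equals that of the peakon system up to an error
  that vanishes for even \<open>N\<close> and is independent of \<open>i\<close>. Hence the Hamiltonian vector field is
  the peakon field minus a common translation \<open>c\<close>, where \<open>c = 0\<close> if \<open>N\<close> is even. Conservation of
  \<open>I\<close> follows from skew-symmetry of the bracket and, for odd \<open>N\<close>, from \<open>\<Sum>\<^sub>k v\<^sub>k = 0\<close>.
\<close>

subsection \<open>Alternating sums\<close>

lemma sum_alternating: "(\<Sum>r<n. (-1) ^ r) = (of_bool (odd n) :: real)"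
  by (induction n) auto

text \<open>For \<open>N = q + 1\<close> only the indices below \<open>q\<close> contribute, all
  with sign \<open>+1\<close>. Each later index has sign \<open>-1\<close> and toggles the value
  between 0 and 1.\<close>

lemma sum_sgn_alternating:
  assumes "q < N"
  shows "(\<Sum>r<N. sgn (real q - real r) * (-1) ^ r) = of_bool (even N)"
  using Suc_leI[OF assms]
proof (induction N rule: nat_induct_at_least)
  case base
  have "(\<Sum>r<q. sgn (real q - real r) * (-1) ^ r) = (\<Sum>r<q. (-1) ^ r :: real)"
    by (intro sum.cong) auto
  then show ?case
    by (simp add: sum_alternating)
next
  case (Suc N)
  then show ?case by auto
qed

text \<open>Below \<open>q\<close> the second sign is \<open>+1\<close>, which leaves
  \<open>sum_sgn_alternating\<close> with upper bound \<open>q\<close>; that requires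
  \<open>p < q\<close>, so \<open>p = q\<close> is separate. Beyond \<open>q\<close> the two signs
  multiply to \<open>-1\<close>, which toggles the parity term.\<close>

lemma sum_sgn_sgn_alternating_le:
  assumes "p \<le> q" "q < N"
  shows "(\<Sum>r<N. sgn (real r - real p) * sgn (real q - real r) * (-1) ^ r)
    = of_bool (p = q) * (-1) ^ q - of_bool (odd N)"
  using Suc_leI[OF assms(2)]
proof (induction N rule: nat_induct_at_least)
  case base
  have "(\<Sum>r<q. sgn (real r - real p) * sgn (real q - real r) * (-1) ^ r)
      = (\<Sum>r<q. - (sgn (real p - real r) * (-1) ^ r))"
    by (intro sum.cong) (auto simp: sgn_if)
  also have "\<dots> = - (\<Sum>r<q. sgn (real p - real r) * (-1) ^ r)"
    by (simp add: sum_negf)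
  also have "\<dots> = of_bool (p = q) * (-1) ^ q - of_bool (even q)"
  proof (cases "p = q")
    case True
    have "(\<Sum>r<q. sgn (real p - real r) * (-1) ^ r) = (\<Sum>r<q. (-1) ^ r :: real)"
      using True by (intro sum.cong) auto
    then show ?thesis
      using True by (auto simp: sum_alternating)
  next
    case False
    then show ?thesis
      using assms(1) by (simp add: sum_sgn_alternating)
  qed
  finally show ?case by simp
next
  case (Suc N)
  then show ?case using assms by auto
qed

lemma sum_sgn_sgn_alternating:
  assumes "p < N" "q < N"
  shows "(\<Sum>r<N. sgn (real r - real p) * sgn (real q - real r) * (-1) ^ r)
    = of_bool (p = q) * (-1) ^ q - of_bool (odd N)"
proof (cases "p \<le> q")
  case True
  then show ?thesis using assms by (intro sum_sgn_sgn_alternating_le)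
next
  case False
  \<comment> \<open>Reversing both differences changes two signs, so the sum is symmetric in
    \<open>p\<close> and \<open>q\<close>.\<close>
  have "(\<Sum>r<N. sgn (real r - real p) * sgn (real q - real r) * (-1) ^ r)
      = (\<Sum>r<N. sgn (real r - real q) * sgn (real p - real r) * (-1) ^ r)"
    by (intro sum.cong) (auto simp: sgn_if)
  then show ?thesis
    using False assms sum_sgn_sgn_alternating_le[of q p N] by auto
qed

subsection \<open>The ranking of the positions\<close>

lemma sgn_eq_1_iff_pos: "sgn (r::real) = 1 \<longleftrightarrow> 0 < r"
  by (auto simp: sgn_if)

lemma sgn_count_altdef: "sgn_count N x k = card {j \<in> {1..N}. x k < x j}"
  by (simp add: sgn_count_def sgn_eq_1_iff_pos)

lemma distinct_positions_eq_iff: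
  assumes "distinct_positions N x" "i \<in> {1..N}" "k \<in> {1..N}"
  shows "x i = x k \<longleftrightarrow> i = k"
  using assms unfolding distinct_positions_def by (rule inj_on_eq_iff)

lemma sgn_count_less:
  assumes "i \<in> {1..N}" "x k < x i"
  shows "sgn_count N x i < sgn_count N x k"
  unfolding sgn_count_altdef
proof (rule psubset_card_mono)
  have "i \<in> {j \<in> {1..N}. x k < x j}" "i \<notin> {j \<in> {1..N}. x i < x j}"
    using assms by simp_all
  moreover have "{j \<in> {1..N}. x i < x j} \<subseteq> {j \<in> {1..N}. x k < x j}"
    using assms(2) by (auto dest: less_trans)
  ultimately show "{j \<in> {1..N}. x i < x j} \<subset> {j \<in> {1..N}. x k < x j}"
    by blast
qed simp

text \<open>The rank reverses the order of the positions, hence the exchanged arguments. Signs of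
  position differences thereby become signs of integers, to which the alternating sums
  apply.\<close>

lemma sgn_sgn_count_diff:
  assumes "distinct_positions N x" "i \<in> {1..N}" "k \<in> {1..N}"
  shows "sgn (real (sgn_count N x k) - real (sgn_count N x i)) = sgn (x i - x k)"
proof (cases "x i" "x k" rule: linorder_cases)
  case less
  then show ?thesis using sgn_count_less[of k N x i] assms by simp
next
  case equal
  then have "i = k" using assms by (simp only: distinct_positions_eq_iff)
  then show ?thesis by simp
next
  case greater
  then show ?thesis using sgn_count_less[of i N x k] assms by simp
qed

lemma sgn_count_lt:
  assumes "k \<in> {1..N}"
  shows "sgn_count N x k < N"
proof -
  have "k \<notin> {j \<in> {1..N}. x k < x j}" by simp
  with assms have "{j \<in> {1..N}. x k < x j} \<subset> {1..N}" by blast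
  then have "sgn_count N x k < card {1..N}"
    unfolding sgn_count_altdef by (intro psubset_card_mono) simp_all
  then show ?thesis by simp
qed

lemma sgn_count_eq_iff:
  assumes "distinct_positions N x" "i \<in> {1..N}" "k \<in> {1..N}"
  shows "sgn_count N x i = sgn_count N x k \<longleftrightarrow> i = k"
proof
  assume "sgn_count N x i = sgn_count N x k"
  with sgn_sgn_count_diff[OF assms] have "x i = x k" by (simp add: sgn_0_0)
  then show "i = k" using assms by (simp only: distinct_positions_eq_iff)
qed simp

text \<open>The \<open>N\<close> ranks are distinct and below \<open>N\<close>, so they fill the
  range, and sums over particles become sums over ranks.\<close>

lemma bij_betw_sgn_count:
  assumes "distinct_positions N x"
  shows "bij_betw (sgn_count N x) {1..N} {..<N}"
proof -
  have inj: "inj_on (sgn_count N x) {1..N}"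
    using sgn_count_eq_iff[OF assms] by (auto intro!: inj_onI)
  have "sgn_count N x ` {1..N} = {..<N}"
    using sgn_count_lt card_image[OF inj] by (intro card_subset_eq) auto
  with inj show ?thesis by (simp add: bij_betw_def)
qed

lemma sum_sgn_sgn_count:
  assumes "distinct_positions N x" "j \<in> {1..N}"
  shows "(\<Sum>k\<in>{1..N}. sgn (x k - x j) * (-1) ^ sgn_count N x k) = of_bool (even N)"
proof -
  let ?s = "sgn_count N x"
  have "(\<Sum>k\<in>{1..N}. sgn (x k - x j) * (-1) ^ ?s k)
      = (\<Sum>k\<in>{1..N}. sgn (real (?s j) - real (?s k)) * (-1) ^ ?s k)"
    using assms by (intro sum.cong refl) (simp add: sgn_sgn_count_diff)
  also have "\<dots> = (\<Sum>r<N. sgn (real (?s j) - real r) * (-1) ^ r)"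
    by (rule sum.reindex_bij_betw[OF bij_betw_sgn_count[OF assms(1)]])
  also have "\<dots> = of_bool (even N)"
    using assms(2) by (intro sum_sgn_alternating sgn_count_lt)
  finally show ?thesis .
qed

text \<open>The Kronecker term will produce the self-interaction \<open>(a i)\<^sup>2\<close>; the
  parity term, which depends on neither \<open>i\<close> nor \<open>j\<close>, will produce the
  common translation.\<close>

lemma sum_sgn_sgn_sgn_count:
  assumes "distinct_positions N x" "i \<in> {1..N}" "j \<in> {1..N}"
  shows "(\<Sum>k\<in>{1..N}. sgn (x i - x k) * sgn (x k - x j) * (-1) ^ sgn_count N x k)
    = of_bool (i = j) * (-1) ^ sgn_count N x j - of_bool (odd N)"
proof -
  let ?s = "sgn_count N x"
  have "(\<Sum>k\<in>{1..N}. sgn (x i - x k) * sgn (x k - x j) * (-1) ^ ?s k)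
      = (\<Sum>k\<in>{1..N}. sgn (real (?s k) - real (?s i)) * sgn (real (?s j) - real (?s k)) * (-1) ^ ?s k)"
    using assms by (intro sum.cong refl) (simp add: sgn_sgn_count_diff)
  also have "\<dots> = (\<Sum>r<N. sgn (real r - real (?s i)) * sgn (real (?s j) - real r) * (-1) ^ r)"
    by (rule sum.reindex_bij_betw[OF bij_betw_sgn_count[OF assms(1)]])
  also have "\<dots> = of_bool (?s i = ?s j) * (-1) ^ ?s j - of_bool (odd N)"
    using assms by (intro sum_sgn_sgn_alternating sgn_count_lt)
  finally show ?thesis
    using sgn_count_eq_iff[OF assms] by simp
qed

subsection \<open>The derivative of the conserved quantity\<close>

text \<open>The gradient of \<open>peakon_I\<close> in the positions, with signs locally constant.
  Each unordered pair occurs twice in the exponential part, so \<open>3/2\<close> becomes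
  \<open>3\<close>; the diagonal may be included because \<open>sgn 0 = 0\<close>.\<close>

definition peakon_grad :: "nat \<Rightarrow> nat \<Rightarrow> phase_fun" where
  "peakon_grad N k = (\<lambda>a x. \<Sum>j\<in>{1..N}.
      sgn (x k - x j) * (-1) ^ (sgn_count N x j + sgn_count N x k) * (a j)\<^sup>2
    - 3 * a k * a j * sgn (x k - x j) * exp (- \<bar>x k - x j\<bar>))"

lemma off_diagonal_eq:
  "{(i, j). i \<in> A \<and> j \<in> A \<and> i \<noteq> j} = A \<times> A - (\<lambda>i. (i, i)) ` A"
  by auto

lemma eventually_sgn_eq:
  fixes f :: "real \<Rightarrow> real"
  assumes "isCont f t" "f t \<noteq> 0"
  shows "\<forall>\<^sub>F \<tau> in nhds t. sgn (f \<tau>) = sgn (f t)"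
proof -
  have lim: "(f \<longlongrightarrow> f t) (nhds t)"
    using assms(1) by (simp add: continuous_at tendsto_nhds_iff)
  show ?thesis
  proof (cases "f t > 0")
    case True
    with lim have "\<forall>\<^sub>F \<tau> in nhds t. f \<tau> > 0" by (rule order_tendstoD)
    then show ?thesis by eventually_elim (use True in simp)
  next
    case False
    with assms(2) have "f t < 0" by simp
    with lim have "\<forall>\<^sub>F \<tau> in nhds t. f \<tau> < 0" by (rule order_tendstoD)
    then show ?thesis by eventually_elim (use \<open>f t < 0\<close> in simp)
  qed
qed

text \<open>Leaving the velocities \<open>X\<close> arbitrary covers two uses: the time derivative
  along solutions and the partial derivative in a single position.\<close>

lemma has_real_derivative_peakon_I:
  assumes a: "\<And>i. i \<in> {1..N} \<Longrightarrow> ((\<lambda>\<tau>. a \<tau> i) has_real_derivative 0) (at t)"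
    and x: "\<And>i. i \<in> {1..N} \<Longrightarrow> ((\<lambda>\<tau>. x \<tau> i) has_real_derivative X i) (at t)"
    and distinct: "distinct_positions N (x t)"
  shows "((\<lambda>\<tau>. peakon_I N (a \<tau>) (x \<tau>)) has_real_derivative
    (\<Sum>k\<in>{1..N}. peakon_grad N k (a t) (x t) * X k)) (at t)"
proof -
  let ?S = "{1..N}"
  let ?P = "{(i, j). i \<in> ?S \<and> j \<in> ?S \<and> i \<noteq> j}"
  define \<sigma> where "\<sigma> i j = sgn (x t i - x t j)" for i j
  define \<epsilon> where "\<epsilon> i = ((-1) ^ sgn_count N (x t) i :: real)" for i
  \<comment> \<open>With the sign frozen, the absolute value in the exponent is a linear function,
    hence differentiable; \<open>w_eq\<close> restores the absolute value.\<close>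
  define w where "w i j = a t i * a t j * \<sigma> i j * exp (- (\<sigma> i j * (x t i - x t j)))" for i j
  have w_eq: "w i j = a t i * a t j * \<sigma> i j * exp (- \<bar>x t i - x t j\<bar>)" for i j
    unfolding w_def \<sigma>_def by (metis abs_sgn mult.commute)
  \<comment> \<open>the summands of \<open>I\<close> with all signs frozen at time \<open>t\<close>\<close>
  define F where "F \<tau> = (\<lambda>(i, j). \<sigma> i j * (\<epsilon> j * \<epsilon> i) * (a \<tau> j)\<^sup>2 * x \<tau> i
      + 3/2 * a \<tau> i * a \<tau> j * exp (- (\<sigma> i j * (x \<tau> i - x \<tau> j))))" for \<tau>
  have "\<forall>\<^sub>F \<tau> in nhds t. sgn (x \<tau> i - x \<tau> j) = \<sigma> i j" if "i \<in> ?S" "j \<in> ?S" for i j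
  proof (cases "i = j")
    case False
    then have "x t i - x t j \<noteq> 0"
      using that distinct by (simp only: distinct_positions_eq_iff right_minus_eq not_False_eq_True)
    moreover have "isCont (\<lambda>\<tau>. x \<tau> i - x \<tau> j) t"
      by (intro continuous_diff DERIV_isCont[OF x] that)
    ultimately show ?thesis
      unfolding \<sigma>_def by (intro eventually_sgn_eq)
  qed (simp add: \<sigma>_def)
  then have "\<forall>\<^sub>F \<tau> in nhds t. \<forall>i\<in>?S. \<forall>j\<in>?S. sgn (x \<tau> i - x \<tau> j) = \<sigma> i j"
    by (intro eventually_ball_finite ballI) auto
  then have ev: "\<forall>\<^sub>F \<tau> in nhds t. peakon_I N (a \<tau>) (x \<tau>) = sum (F \<tau>) ?P"
  proof eventually_elim
    case (elim \<tau>)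
    have "sgn_count N (x \<tau>) i = sgn_count N (x t) i" if "i \<in> ?S" for i
    proof -
      have "{j \<in> ?S. sgn (x \<tau> j - x \<tau> i) = 1} = {j \<in> ?S. sgn (x t j - x t i) = 1}"
        using elim that by (auto simp: \<sigma>_def)
      then show ?thesis by (simp add: sgn_count_def)
    qed
    moreover have "\<bar>x \<tau> i - x \<tau> j\<bar> = \<sigma> i j * (x \<tau> i - x \<tau> j)" if "i \<in> ?S" "j \<in> ?S" for i j
      using elim that by (metis abs_sgn mult.commute)
    ultimately show ?case
      unfolding peakon_I_def F_def using elim
      by (intro sum.cong refl) (auto simp: \<epsilon>_def power_add)
  qed
  define D where "D = (\<lambda>(i, j). \<sigma> i j * (\<epsilon> j * \<epsilon> i) * (a t j)\<^sup>2 * X i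
      - 3/2 * w i j * (X i - X j))"
  have "((\<lambda>\<tau>. F \<tau> p) has_real_derivative D p) (at t)" if "p \<in> ?P" for p
  proof -
    obtain i j where p: "p = (i, j)" by (cases p)
    with that have ij: "i \<in> ?S" "j \<in> ?S" by simp_all
    show ?thesis
      unfolding p F_def D_def w_def prod.case
      by (auto intro!: derivative_eq_intros a x ij simp: field_simps)
  qed
  then have "((\<lambda>\<tau>. sum (F \<tau>) ?P) has_real_derivative sum D ?P) (at t)"
    by (rule DERIV_sum)
  then have "((\<lambda>\<tau>. peakon_I N (a \<tau>) (x \<tau>)) has_real_derivative sum D ?P) (at t)"
    using DERIV_cong_ev[OF refl ev refl] by blast
  moreover have "sum D ?P = (\<Sum>k\<in>?S. peakon_grad N k (a t) (x t) * X k)"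
  proof -
    have w_swap: "w j i = - w i j" for i j
    proof -
      have "\<sigma> j i = - \<sigma> i j" unfolding \<sigma>_def by (metis minus_diff_eq sgn_minus)
      then show ?thesis by (simp add: w_eq abs_minus_commute)
    qed
    define A where "A i j = \<sigma> i j * (\<epsilon> j * \<epsilon> i) * (a t j)\<^sup>2 * X i" for i j
    have D_eq: "D (i, j) = A i j - 3/2 * (w i j * X i) + 3/2 * (w i j * X j)" for i j
      by (simp add: D_def A_def right_diff_distrib)
    have "sum D ?P = sum D (?S \<times> ?S)"
      unfolding off_diagonal_eq
      by (intro sum.mono_neutral_left) (auto simp: D_def \<sigma>_def w_def)
    also have "\<dots> = (\<Sum>i\<in>?S. \<Sum>j\<in>?S. D (i, j))"
      by (simp only: sum.cartesian_product case_prod_eta)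
    also have "\<dots> = (\<Sum>i\<in>?S. \<Sum>j\<in>?S. A i j) - 3/2 * (\<Sum>i\<in>?S. \<Sum>j\<in>?S. w i j * X i)
        + 3/2 * (\<Sum>i\<in>?S. \<Sum>j\<in>?S. w i j * X j)"
      by (simp only: D_eq sum.distrib sum_subtractf sum_distrib_left)
    \<comment> \<open>Antisymmetry of \<open>w\<close> turns the \<open>X j\<close> part into a
      second copy of the \<open>X i\<close> part, which doubles the factor
      \<open>3/2\<close>.\<close>
    also have "(\<Sum>i\<in>?S. \<Sum>j\<in>?S. w i j * X j) = (\<Sum>i\<in>?S. \<Sum>j\<in>?S. - (w i j * X i))"
      by (subst sum.swap) (intro sum.cong refl, subst w_swap, simp)
    also have "\<dots> = - (\<Sum>i\<in>?S. \<Sum>j\<in>?S. w i j * X i)"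
      by (simp only: sum_negf)
    finally have "sum D ?P
        = (\<Sum>i\<in>?S. \<Sum>j\<in>?S. A i j) - 3 * (\<Sum>i\<in>?S. \<Sum>j\<in>?S. w i j * X i)"
      by linarith
    also have "\<dots> = (\<Sum>i\<in>?S. \<Sum>j\<in>?S. A i j - 3 * (w i j * X i))"
      by (simp only: sum_subtractf sum_distrib_left)
    also have "\<dots> = (\<Sum>k\<in>?S. peakon_grad N k (a t) (x t) * X k)"
      unfolding peakon_grad_def \<sigma>_def \<epsilon>_def w_eq A_def sum_distrib_right
      by (intro sum.cong refl) (simp add: algebra_simps power_add)
    finally show ?thesis .
  qed
  ultimately show ?thesis by simp
qed

lemma partial_x_peakon_I:
  assumes "distinct_positions N x" "k \<in> {1..N}"
  shows "partial_x k (\<lambda>a x. c * peakon_I N a x) a x = c * peakon_grad N k a x"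
proof -
  \<comment> \<open>The curve moves only particle \<open>k\<close>, at unit speed.\<close>
  have "((\<lambda>u. peakon_I N a (x(k := u))) has_real_derivative
      (\<Sum>i\<in>{1..N}. peakon_grad N i a (x(k := x k)) * (if i = k then 1 else 0))) (at (x k))"
    using assms(1)
    by (intro has_real_derivative_peakon_I) (auto intro!: derivative_eq_intros)
  also have "(\<Sum>i\<in>{1..N}. peakon_grad N i a (x(k := x k)) * (if i = k then 1 else 0)) = peakon_grad N k a x"
    using assms(2) by (simp add: if_distrib cong: if_cong)
  finally show ?thesis
    unfolding partial_x_def by (intro DERIV_imp_deriv DERIV_cmult)
qed

subsection \<open>The Hamiltonian vector field\<close>

lemma sum_symmetric_pairs:
  fixes h :: "'a::linorder \<Rightarrow> 'a \<Rightarrow> real"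
  assumes "finite A" "\<And>j k. h j k = h k j" "\<And>j. h j j = 0"
  shows "(\<Sum>j\<in>A. \<Sum>k\<in>A. h j k)
    = 2 * (\<Sum>(j, k)\<in>{(j, k). j \<in> A \<and> k \<in> A \<and> j < k}. h j k)"
proof -
  let ?L = "{(j, k). j \<in> A \<and> k \<in> A \<and> j < k}" and ?U = "{(j, k). j \<in> A \<and> k \<in> A \<and> k < j}"
  have fin: "finite ?L" "finite ?U"
    by (rule finite_subset[of _ "A \<times> A"]; use assms(1) in auto)+
  have "(\<Sum>j\<in>A. \<Sum>k\<in>A. h j k) = (\<Sum>(j, k)\<in>A \<times> A. h j k)"
    by (simp add: sum.cartesian_product)
  also have "\<dots> = (\<Sum>(j, k)\<in>?L \<union> ?U. h j k)"
    using assms by (intro sum.mono_neutral_right) (auto simp: not_less_iff_gr_or_eq)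
  also have "\<dots> = (\<Sum>(j, k)\<in>?L. h j k) + (\<Sum>(j, k)\<in>?U. h j k)"
    by (rule sum.union_disjoint[OF fin]) auto
  also have "(\<Sum>(j, k)\<in>?U. h j k) = (\<Sum>(j, k)\<in>?L. h j k)"
    by (rule sum.reindex_bij_witness[of _ prod.swap prod.swap]) (auto simp: assms(2))
  finally show ?thesis by simp
qed

text \<open>Both sides vanish unless \<open>u\<close> lies between \<open>v\<close> and \<open>w\<close>, where the distances add up.\<close>

lemma sgn_exp_between:
  fixes u v w :: real
  assumes "u \<noteq> v" "u \<noteq> w"
  shows "(sgn (u - v) - sgn (u - w)) * sgn (w - v) * exp (- \<bar>w - v\<bar>)
    = (1 - sgn (u - v) * sgn (u - w)) * exp (- \<bar>u - v\<bar> - \<bar>u - w\<bar>)"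
  using assms by (auto simp: sgn_if abs_if)

text \<open>Symmetrising the double sum in \<open>j\<close> and \<open>k\<close> yields the
  difference of signs in \<open>sgn_exp_between\<close>. Pairs containing \<open>i\<close> give the
  single sum of \<open>mch_x_dot\<close>, the remaining pairs its double sum.\<close>

lemma sum_sgn_sgn_exp:
  assumes "distinct_positions N x" "i \<in> {1..N}"
  shows "2/3 * (\<Sum>k\<in>{1..N}. sgn (x i - x k)
        * (\<Sum>j\<in>{1..N}. 3 * a k * a j * sgn (x k - x j) * exp (- \<bar>x k - x j\<bar>)))
    = 2/3 * (a i)\<^sup>2 - mch_x_dot N i a x"
proof -
  let ?S = "{1..N}"
  let ?S' = "{1..N} - {i}"
  define G where "G j k = (sgn (x i - x j) - sgn (x i - x k)) * sgn (x k - x j)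
      * (a j * a k * exp (- \<bar>x k - x j\<bar>))" for j k
  have neq: "x i \<noteq> x j" if "j \<in> ?S'" for j
    using assms that distinct_positions_eq_iff[of N x i j] by blast
  have G_commute: "G j k = G k j" for j k
  proof -
    have "sgn (x k - x j) = - sgn (x j - x k)" by (metis minus_diff_eq sgn_minus)
    then show ?thesis by (simp add: G_def abs_minus_commute algebra_simps)
  qed
  have G_eq: "G j k = a j * a k * (1 - sgn (x i - x j) * sgn (x i - x k))
        * exp (- \<bar>x i - x j\<bar> - \<bar>x i - x k\<bar>)" if "j \<in> ?S'" "k \<in> ?S'" for j k
    using sgn_exp_between[OF neq neq, OF that] by (simp add: G_def mult_ac)
  define T where "T k j = sgn (x i - x k) * (a k * a j * sgn (x k - x j) * exp (- \<bar>x k - x j\<bar>))"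
    for j k
  have T_sym: "T k j + T j k = - G j k" for j k
  proof -
    have "sgn (x k - x j) = - sgn (x j - x k)" by (metis minus_diff_eq sgn_minus)
    then show ?thesis by (simp add: T_def G_def abs_minus_commute algebra_simps)
  qed
  have "2/3 * (\<Sum>k\<in>?S. sgn (x i - x k)
        * (\<Sum>j\<in>?S. 3 * a k * a j * sgn (x k - x j) * exp (- \<bar>x k - x j\<bar>)))
      = 2 * (\<Sum>k\<in>?S. \<Sum>j\<in>?S. T k j)"
    by (simp add: T_def sum_distrib_left mult_ac)
  also have "\<dots> = (\<Sum>k\<in>?S. \<Sum>j\<in>?S. T k j) + (\<Sum>k\<in>?S. \<Sum>j\<in>?S. T j k)"
    by (subst (3) sum.swap) simp
  also have "\<dots> = (\<Sum>k\<in>?S. \<Sum>j\<in>?S. - G j k)"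
    by (simp add: sum.distrib[symmetric] T_sym)
  also have "\<dots> = - (\<Sum>k\<in>?S. \<Sum>j\<in>?S. G j k)"
    by (simp add: sum_negf)
  \<comment> \<open>\<open>G_eq\<close> holds only away from index \<open>i\<close>, so row and
    column \<open>i\<close> are split off; they agree by symmetry and meet in
    \<open>G i i = 0\<close>.\<close>
  also have "(\<Sum>k\<in>?S. \<Sum>j\<in>?S. G j k)
      = 2 * (\<Sum>j\<in>?S'. G j i) + (\<Sum>j\<in>?S'. \<Sum>k\<in>?S'. G j k)"
  proof -
    have "(\<Sum>k\<in>?S. \<Sum>j\<in>?S. G j k) = (\<Sum>k\<in>?S. G i k + (\<Sum>j\<in>?S'. G j k))"
      using assms(2) by (intro sum.cong refl sum.remove) auto
    also have "\<dots> = (\<Sum>k\<in>?S. G i k) + (\<Sum>k\<in>?S. \<Sum>j\<in>?S'. G j k)"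
      by (rule sum.distrib)
    also have "(\<Sum>k\<in>?S. G i k) = G i i + (\<Sum>k\<in>?S'. G i k)"
      using assms(2) by (intro sum.remove) auto
    also have "(\<Sum>k\<in>?S. \<Sum>j\<in>?S'. G j k) = (\<Sum>j\<in>?S'. G j i) + (\<Sum>k\<in>?S'. \<Sum>j\<in>?S'. G j k)"
      using assms(2) by (intro sum.remove) auto
    also have "G i i = 0" by (simp add: G_def)
    also have "(\<Sum>k\<in>?S'. G i k) = (\<Sum>k\<in>?S'. G k i)"
      by (simp add: G_commute)
    also have "(\<Sum>k\<in>?S'. \<Sum>j\<in>?S'. G j k) = (\<Sum>j\<in>?S'. \<Sum>k\<in>?S'. G j k)"
      by (rule sum.swap)
    finally show ?thesis by simp
  qed
  \<comment> \<open>For \<open>k = i\<close> one sign vanishes and the other appears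
    squared.\<close>
  also have "(\<Sum>j\<in>?S'. G j i) = a i * (\<Sum>j\<in>?S'. a j * exp (- \<bar>x i - x j\<bar>))"
    unfolding sum_distrib_left
  proof (intro sum.cong refl)
    fix j assume "j \<in> ?S'"
    then have "sgn (x i - x j) * sgn (x i - x j) = 1"
      using neq by (simp add: sgn_if)
    then show "G j i = a i * (a j * exp (- \<bar>x i - x j\<bar>))"
      by (simp add: G_def)
  qed
  also have "(\<Sum>j\<in>?S'. \<Sum>k\<in>?S'. G j k)
      = 2 * (\<Sum>(j, k)\<in>{(j, k). j \<in> ?S' \<and> k \<in> ?S' \<and> j < k}. G j k)"
    by (intro sum_symmetric_pairs G_commute) (auto simp: G_def)
  also have "(\<Sum>(j, k)\<in>{(j, k). j \<in> ?S' \<and> k \<in> ?S' \<and> j < k}. G j k)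
      = (\<Sum>(j, k)\<in>{(j, k). j \<in> ?S' \<and> k \<in> ?S' \<and> j < k}.
          a j * a k * (1 - sgn (x i - x j) * sgn (x i - x k)) * exp (- \<bar>x i - x j\<bar> - \<bar>x i - x k\<bar>))"
    by (intro sum.cong refl) (use G_eq in auto)
  finally show ?thesis
    by (simp add: mch_x_dot_def)
qed

text \<open>The translation \<open>c\<close> of the outline, common to all particles. The factor
  \<open>2/3\<close> is \<open>1/2\<close> from the bracket times \<open>4/3\<close> from the
  Hamiltonian.\<close>

definition drift :: "nat \<Rightarrow> phase_fun" where
  "drift N a x = of_bool (odd N) * 2/3 * (\<Sum>j\<in>{1..N}. (-1) ^ sgn_count N x j * (a j)\<^sup>2)"

text \<open>Exchanging the sums reduces the quadratic part to \<open>sum_sgn_sgn_sgn_count\<close>,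
  and \<open>sum_sgn_sgn_exp\<close> gives the exponential part. The two terms
  \<open>2/3 * (a i)\<^sup>2\<close> cancel in the difference.\<close>

lemma sum_sgn_peakon_grad:
  assumes "distinct_positions N x" "i \<in> {1..N}"
  shows "2/3 * (\<Sum>k\<in>{1..N}. sgn (x i - x k) * peakon_grad N k a x)
    = mch_x_dot N i a x - drift N a x"
proof -
  let ?S = "{1..N}" and ?s = "sgn_count N x"
  have "(\<Sum>k\<in>?S. sgn (x i - x k) * (\<Sum>j\<in>?S. sgn (x k - x j) * (-1) ^ (?s j + ?s k) * (a j)\<^sup>2))
      = (\<Sum>j\<in>?S. (-1) ^ ?s j * (a j)\<^sup>2 * (\<Sum>k\<in>?S. sgn (x i - x k) * sgn (x k - x j) * (-1) ^ ?s k))"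
    unfolding sum_distrib_left by (subst sum.swap) (simp add: power_add mult_ac)
  also have "\<dots> = (\<Sum>j\<in>?S. (if i = j then (a j)\<^sup>2 else 0) - of_bool (odd N) * ((-1) ^ ?s j * (a j)\<^sup>2))"
    using assms
    by (intro sum.cong refl) (simp only: sum_sgn_sgn_sgn_count, simp add: algebra_simps)
  also have "\<dots> = (a i)\<^sup>2 - 3/2 * drift N a x"
    using assms(2)
    by (simp add: sum_subtractf drift_def)
  finally have "2/3 * (\<Sum>k\<in>?S. sgn (x i - x k)
        * (\<Sum>j\<in>?S. sgn (x k - x j) * (-1) ^ (?s j + ?s k) * (a j)\<^sup>2))
      = 2/3 * (a i)\<^sup>2 - drift N a x" by simp
  with sum_sgn_sgn_exp[OF assms, of a] show ?thesis
    unfolding peakon_grad_def sum_subtractf right_diff_distrib by linarith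
qed

section \<open>Orthogonality of the gradient and the peakon field\<close>

lemma sum_antisymmetric:
  fixes f :: "'a \<Rightarrow> 'a \<Rightarrow> real"
  assumes "\<And>i j. f j i = - f i j"
  shows "(\<Sum>i\<in>A. \<Sum>j\<in>A. f i j) = 0"
proof -
  have "(\<Sum>i\<in>A. \<Sum>j\<in>A. f i j) = (\<Sum>i\<in>A. \<Sum>j\<in>A. f j i)"
    by (rule sum.swap)
  also have "\<dots> = (\<Sum>i\<in>A. \<Sum>j\<in>A. - f i j)"
    by (intro sum.cong refl assms)
  also have "\<dots> = - (\<Sum>i\<in>A. \<Sum>j\<in>A. f i j)"
    by (simp add: sum_negf)
  finally show ?thesis by simp
qed

text \<open>This is the derivative under a common translation. The exponential part cancels by
  antisymmetry, and the rest reduces to \<open>sum_sgn_sgn_count\<close>.\<close>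

lemma sum_peakon_grad:
  assumes "distinct_positions N x"
  shows "(\<Sum>k\<in>{1..N}. peakon_grad N k a x)
    = of_bool (even N) * (\<Sum>j\<in>{1..N}. (-1) ^ sgn_count N x j * (a j)\<^sup>2)"
proof -
  let ?S = "{1..N}" and ?s = "sgn_count N x"
  have "(\<Sum>k\<in>?S. \<Sum>j\<in>?S. 3 * a k * a j * sgn (x k - x j) * exp (- \<bar>x k - x j\<bar>)) = 0"
  proof (rule sum_antisymmetric)
    fix i j
    have "sgn (x j - x i) = - sgn (x i - x j)" by (metis minus_diff_eq sgn_minus)
    then show "3 * a j * a i * sgn (x j - x i) * exp (- \<bar>x j - x i\<bar>)
        = - (3 * a i * a j * sgn (x i - x j) * exp (- \<bar>x i - x j\<bar>))"
      by (simp add: abs_minus_commute)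
  qed
  then have "(\<Sum>k\<in>?S. peakon_grad N k a x)
      = (\<Sum>k\<in>?S. \<Sum>j\<in>?S. sgn (x k - x j) * (-1) ^ (?s j + ?s k) * (a j)\<^sup>2)"
    by (simp add: peakon_grad_def sum_subtractf)
  also have "\<dots> = (\<Sum>j\<in>?S. (-1) ^ ?s j * (a j)\<^sup>2 * (\<Sum>k\<in>?S. sgn (x k - x j) * (-1) ^ ?s k))"
    unfolding sum_distrib_left by (subst sum.swap) (simp add: power_add mult_ac)
  also have "\<dots> = (\<Sum>j\<in>?S. (-1) ^ ?s j * (a j)\<^sup>2 * of_bool (even N))"
    using assms by (intro sum.cong refl) (simp only: sum_sgn_sgn_count)
  finally show ?thesis by (simp add: sum_distrib_left mult_ac)
qed

text \<open>The peakon field is the Hamiltonian field plus \<open>drift\<close>. The Hamiltonian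
  part drops out by skew-symmetry; in the drift part, factors for odd and even \<open>N\<close>
  multiply to zero.\<close>

lemma sum_peakon_grad_mch_x_dot:
  assumes "distinct_positions N x"
  shows "(\<Sum>k\<in>{1..N}. peakon_grad N k a x * mch_x_dot N k a x) = 0"
proof -
  let ?S = "{1..N}"
  have "(\<Sum>k\<in>?S. peakon_grad N k a x * mch_x_dot N k a x)
      = (\<Sum>k\<in>?S. peakon_grad N k a x
          * (2/3 * (\<Sum>m\<in>?S. sgn (x k - x m) * peakon_grad N m a x) + drift N a x))"
    using assms by (intro sum.cong refl) (simp only: sum_sgn_peakon_grad, simp)
  also have "\<dots> = 2/3 * (\<Sum>k\<in>?S. \<Sum>m\<in>?S.
        sgn (x k - x m) * (peakon_grad N k a x * peakon_grad N m a x))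
      + drift N a x * (\<Sum>k\<in>?S. peakon_grad N k a x)"
    by (simp add: sum_distrib_left sum.distrib[symmetric] algebra_simps)
  also have "(\<Sum>k\<in>?S. \<Sum>m\<in>?S. sgn (x k - x m) * (peakon_grad N k a x * peakon_grad N m a x)) = 0"
  proof (rule sum_antisymmetric)
    fix i j
    have "sgn (x j - x i) = - sgn (x i - x j)" by (metis minus_diff_eq sgn_minus)
    then show "sgn (x j - x i) * (peakon_grad N j a x * peakon_grad N i a x)
        = - (sgn (x i - x j) * (peakon_grad N i a x * peakon_grad N j a x))" by simp
  qed
  also have "drift N a x * (\<Sum>k\<in>?S. peakon_grad N k a x) = 0"
    by (simp only: sum_peakon_grad[OF assms]) (simp add: drift_def)
  finally show ?thesis by simp
qed

section \<open>Hamilton's equations for the peakon bracket\<close>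

lemma peakon_bracket_coord_a: "peakon_bracket N (coord_a i) H a x = 0"
  by (simp add: peakon_bracket_def bracket_def coord_a_def partial_x_def)

lemma peakon_bracket_coord_x:
  assumes "i \<in> {1..N}"
  shows "peakon_bracket N (coord_x i) H a x
    = (\<Sum>k\<in>{1..N}. 1/2 * sgn (x i - x k) * partial_x k H a x)"
proof -
  have "partial_x m (coord_x i) a x = (if m = i then 1 else 0)" for m
    by (cases "m = i") (simp_all add: partial_x_def coord_x_def)
  then have "peakon_bracket N (coord_x i) H a x
      = (\<Sum>m\<in>{1..N}. \<Sum>k\<in>{1..N}. if m = i then 1/2 * sgn (x m - x k) * partial_x k H a x else 0)"
    unfolding peakon_bracket_def bracket_def by (intro sum.cong refl) simp
  also have "\<dots> = (\<Sum>k\<in>{1..N}. 1/2 * sgn (x i - x k) * partial_x k H a x)"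
    using assms by (subst sum.swap) simp
  finally show ?thesis .
qed

lemma peakon_bracket_coord_x_peakon_I:
  assumes "distinct_positions N x" "i \<in> {1..N}"
  shows "peakon_bracket N (coord_x i) (\<lambda>a x. 4/3 * peakon_I N a x) a x
    = mch_x_dot N i a x - drift N a x"
proof -
  have "peakon_bracket N (coord_x i) (\<lambda>a x. 4/3 * peakon_I N a x) a x
      = (\<Sum>k\<in>{1..N}. 1/2 * sgn (x i - x k) * (4/3 * peakon_grad N k a x))"
    unfolding peakon_bracket_coord_x[OF assms(2)]
    using assms(1) by (intro sum.cong refl) (simp only: partial_x_peakon_I)
  also have "\<dots> = 2/3 * (\<Sum>k\<in>{1..N}. sgn (x i - x k) * peakon_grad N k a x)"
    by (simp add: sum_distrib_left mult_ac)
  finally show ?thesis by (simp only: sum_sgn_peakon_grad[OF assms])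
qed

lemma is_hamiltonian_for_peakon_I_iff:
  "is_hamiltonian_for N (peakon_bracket N) (mch_a_dot N) (mch_x_dot N)
      (\<lambda>a x. 4/3 * peakon_I N a x)
    \<longleftrightarrow> (\<forall>a x. distinct_positions N x \<longrightarrow> (\<forall>i\<in>{1..N}. drift N a x = 0))"
proof -
  have "(mch_x_dot N i a x = peakon_bracket N (coord_x i) (\<lambda>a x. 4/3 * peakon_I N a x) a x)
      \<longleftrightarrow> drift N a x = 0" if "distinct_positions N x" "i \<in> {1..N}" for a x i
    unfolding peakon_bracket_coord_x_peakon_I[OF that] by simp
  then show ?thesis
    unfolding is_hamiltonian_for_def
    by (simp add: peakon_bracket_coord_a mch_a_dot_def)
qed

text \<open>A single nonzero amplitude leaves one summand, equal to \<open>1\<close> or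
  \<open>-1\<close>, so the alternating signs cannot cancel.\<close>

lemma drift_nonzero:
  assumes "odd N"
  shows "drift N (\<lambda>j. of_bool (j = 1)) x \<noteq> 0"
proof -
  have "1 \<in> {1..N}" using assms by (cases N) auto
  then have "(\<Sum>j\<in>{1..N}. (-1) ^ sgn_count N x j * (of_bool (j = 1))\<^sup>2)
      = ((-1) ^ sgn_count N x 1 :: real)"
    by (subst sum.remove[of _ 1]) auto
  then show ?thesis using assms by (simp add: drift_def)
qed

section \<open>Permutation invariance, conservation and the parity criterion\<close>

lemma permutation_invariant_peakon_I: "permutation_invariant N (peakon_I N)"
  unfolding permutation_invariant_def
proof (intro allI impI)
  fix \<pi> and a x :: "nat \<Rightarrow> real"
  assume \<pi>: "\<pi> permutes {1..N}"
  \<comment> \<open>Relabelling carries the ranks along, so the sum over pairs only needs reindexing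
    by the diagonal action of \<open>\<pi>\<close>.\<close>
  have count: "sgn_count N (x \<circ> \<pi>) k = sgn_count N x (\<pi> k)" for k
  proof -
    have "card {j \<in> {1..N}. x (\<pi> k) < x (\<pi> j)} = card (\<pi> ` {j \<in> {1..N}. x (\<pi> k) < x (\<pi> j)})"
      by (rule card_image[OF permutes_inj_on[OF \<pi>], symmetric])
    also have "\<pi> ` {j \<in> {1..N}. x (\<pi> k) < x (\<pi> j)} = {j \<in> \<pi> ` {1..N}. x (\<pi> k) < x j}"
      by (rule Compr_image_eq[symmetric])
    finally show ?thesis
      unfolding sgn_count_altdef comp_def permutes_image[OF \<pi>] .
  qed
  let ?P = "{(i, j). i \<in> {1..N} \<and> j \<in> {1..N} \<and> i \<noteq> j}"
  have bij: "bij_betw (map_prod \<pi> \<pi>) ?P ?P"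
  proof (rule bij_betw_byWitness[where f' = "map_prod (inv \<pi>) (inv \<pi>)"])
    have "map_prod \<sigma> \<sigma> ` ?P \<subseteq> ?P" if "\<sigma> permutes {1..N}" for \<sigma>
      using permutes_in_image[OF that] permutes_inj[OF that] by (auto dest: injD)
    from this[OF \<pi>] this[OF permutes_inv[OF \<pi>]]
    show "map_prod \<pi> \<pi> ` ?P \<subseteq> ?P" "map_prod (inv \<pi>) (inv \<pi>) ` ?P \<subseteq> ?P" .
  qed (simp_all add: permutes_inverses[OF \<pi>] split_paired_all)
  show "peakon_I N (a \<circ> \<pi>) (x \<circ> \<pi>) = peakon_I N a x"
    unfolding peakon_I_def count
    by (rule trans[OF sum.cong[OF refl] sum.reindex_bij_betw[OF bij]]) (simp add: case_prod_unfold)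
qed

lemma local_constant_of_motion_peakon_I:
  "local_constant_of_motion N (mch_a_dot N) (mch_x_dot N) (peakon_I N)"
  unfolding local_constant_of_motion_def
proof (intro allI impI ballI)
  fix T a x t
  assume sol: "open T \<and> is_interval T \<and> solution_on N (mch_a_dot N) (mch_x_dot N) T a x"
    and t: "t \<in> T" and distinct: "distinct_positions N (x t)"
  have "((\<lambda>\<tau>. peakon_I N (a \<tau>) (x \<tau>)) has_real_derivative
      (\<Sum>k\<in>{1..N}. peakon_grad N k (a t) (x t) * mch_x_dot N k (a t) (x t))) (at t)"
    using sol t distinct
    by (intro has_real_derivative_peakon_I) (auto simp: solution_on_def mch_a_dot_def)
  then show "((\<lambda>\<tau>. peakon_I N (a \<tau>) (x \<tau>)) has_real_derivative 0) (at t)"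
    by (simp only: sum_peakon_grad_mch_x_dot[OF distinct])
qed

theorem theorem2:
  fixes N :: nat
  assumes "N \<ge> 2"
  shows "permutation_invariant N (peakon_I N)
    \<and> local_constant_of_motion N (mch_a_dot N) (mch_x_dot N) (peakon_I N)
    \<and> (is_hamiltonian_for N (peakon_bracket N) (mch_a_dot N) (mch_x_dot N)
          (\<lambda>a x. 4/3 * peakon_I N a x) \<longleftrightarrow> even N)"
proof (intro conjI permutation_invariant_peakon_I local_constant_of_motion_peakon_I)
  have "even N" if "\<forall>a x. distinct_positions N x \<longrightarrow> (\<forall>i\<in>{1..N}. drift N a x = 0)"
  proof (rule ccontr)
    assume "odd N"
    \<comment> \<open>The witness places particle \<open>j\<close> at position \<open>j\<close>; the
      amplitudes come from \<open>drift_nonzero\<close>.\<close>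
    moreover have "distinct_positions N real" by (simp add: distinct_positions_def)
    moreover have "1 \<in> {1..N}" using assms by simp
    ultimately show False using that drift_nonzero by blast
  qed
  then show "is_hamiltonian_for N (peakon_bracket N) (mch_a_dot N) (mch_x_dot N)
      (\<lambda>a x. 4/3 * peakon_I N a x) \<longleftrightarrow> even N"
    unfolding is_hamiltonian_for_peakon_I_iff by (auto simp: drift_def)
qed

end
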